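(* If $\langle A;\wedge,\vee,^{\perp},0,1,\exists\rangle$ is a quantum monadic algebra and $p_s(x,y)=x^{\perp}\vee(x\wedge y)$, then $\langle A;p_s,0,\exists\rangle$ is a monadic quasi-implication algebra.
   Context: An ortholattice is a bounded lattice $\langle A;\wedge,\vee,0,1\rangle$ with a unary operation $^{\perp}$ such that $x\wedge x^{\perp}=0$, $x\vee x^{\perp}=1$, $x\le y\Rightarrow y^{\perp}\le x^{\perp}$, and $x^{\perp\perp}=x$. An orthomodular lattice is an ortholattice satisfying: $x\le y$ implies $y=x\vee(x^{\perp}\wedge y)$. A quantum monadic algebra is an orthomodular lattice with a unary operation $\exists$ satisfying for all $x,y$: $\exists 0=0$; $x\le\exists x$; $\exists(x\vee y)=\exists x\vee\exists y$; $\exists\exists x=\exists x$; $\exists((\exists x)^{\perp})=(\exists x)^{\perp}$. A quasi-implication algebra is a magma $\langle A;\cdot\rangle$ satisfying, for all $x,y,z$: (1) $(x\cdot y)\cdot x=x$; (2) $(x\cdot y)\cdot(x\cdot z)=(y\cdot x)\cdot(y\cdot z)$; (3) $((x\cdot y)\cdot(y\cdot x))\cdot x=((y\cdot x)\cdot(x\cdot y))\cdot y$. In any quasi-implication algebra $x\cdot x=y\cdot y$ for all $x,y$, and $1$ denotes this common element. A bounded quasi-implication algebra is a quasi-implication algebra with a distinguished element $0$ such that $0\cdot x=1$ for all $x$. A monadic quasi-implication algebra is an algebra $\langle A;\cdot,0,\Diamond\rangle$ such that $\langle A;\cdot,0\rangle$ is a bounded quasi-implication algebra and $\Diamond\colon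 A\to A$ satisfies, for all $x,y$: (a) $\Diamond\Diamond x\cdot\Diamond x=1$ and $x\cdot\Diamond x=1$; (b) $\Diamond(\Diamond x\cdot 0)=\Diamond x\cdot 0$ and $\Diamond 0=0$; (c) $\Diamond(((x\cdot 0)\cdot(y\cdot 0))\cdot x)=((\Diamond x\cdot 0)\cdot(\Diamond y\cdot 0))\cdot\Diamond x$. *)

theory Defs
  imports "HOL-Library.Complemented_Lattices"
begin

text \<open>
  Algebras have a whole type as their carrier.  Orthomodular lattices are the library class
  \<^class>\<open>orthomodular_lattice\<close>, where the orthocomplement is \<open>- x\<close>; the additional class
  operation \<open>x - y\<close> is fixed by the class to be \<open>inf x (- y)\<close>, so it carries no extra structure.
\<close>

locale quantum_monadic_algebra =
  fixes ex :: "'a::orthomodular_lattice \<Rightarrow> 'a"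
  assumes ex_bot: "ex bot = bot"
    and ex_increasing: "x \<le> ex x"
    and ex_sup: "ex (sup x y) = sup (ex x) (ex y)"
    and ex_idem: "ex (ex x) = ex x"
    and ex_compl: "ex (- ex x) = - ex x"

locale quasi_implication_algebra =
  fixes imp :: "'a \<Rightarrow> 'a \<Rightarrow> 'a" (infixl \<open>\<cdot>\<close> 70)
  assumes imp_absorb: "(x \<cdot> y) \<cdot> x = x"
    and imp_exchange: "(x \<cdot> y) \<cdot> (x \<cdot> z) = (y \<cdot> x) \<cdot> (y \<cdot> z)"
    and imp_quasi_comm: "((x \<cdot> y) \<cdot> (y \<cdot> x)) \<cdot> x = ((y \<cdot> x) \<cdot> (x \<cdot> y)) \<cdot> y"
begin

lemma imp_self_eq: "x \<cdot> x = y \<cdot> y"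
  by (metis imp_absorb imp_quasi_comm)

definition one :: 'a (\<open>\<one>\<close>)
  where "\<one> = (THE e. \<forall>x. x \<cdot> x = e)"

lemma imp_self: "x \<cdot> x = \<one>"
proof -
  have "\<one> = x \<cdot> x"
    unfolding one_def using imp_self_eq by (intro the_equality) auto
  then show ?thesis ..
qed

end

locale bounded_quasi_implication_algebra = quasi_implication_algebra imp
  for imp :: "'a \<Rightarrow> 'a \<Rightarrow> 'a" (infixl \<open>\<cdot>\<close> 70) +
  fixes zero :: 'a (\<open>\<zero>\<close>)
  assumes zero_imp: "\<zero> \<cdot> x = \<one>"

locale monadic_quasi_implication_algebra = bounded_quasi_implication_algebra imp zero
  for imp :: "'a \<Rightarrow> 'a \<Rightarrow> 'a" (infixl \<open>\<cdot>\<close> 70)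
    and zero :: 'a (\<open>\<zero>\<close>) +
  fixes dia :: "'a \<Rightarrow> 'a" (\<open>\<diamond> _\<close> [80] 80)
  assumes dia_dia_imp: "\<diamond> \<diamond> x \<cdot> \<diamond> x = \<one>"
    and imp_dia: "x \<cdot> \<diamond> x = \<one>"
    and dia_compl: "\<diamond> (\<diamond> x \<cdot> \<zero>) = \<diamond> x \<cdot> \<zero>"
    and dia_zero: "\<diamond> \<zero> = \<zero>"
    and dia_join:
      "\<diamond> (((x \<cdot> \<zero>) \<cdot> (y \<cdot> \<zero>)) \<cdot> x) = ((\<diamond> x \<cdot> \<zero>) \<cdot> (\<diamond> y \<cdot> \<zero>)) \<cdot> \<diamond> x"

definition sasaki_imp :: "'a::orthomodular_lattice \<Rightarrow> 'a \<Rightarrow> 'a"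
  where "sasaki_imp x y = sup (- x) (inf x y)"

end

theory Submission
  imports Defs
begin

text \<open>Write x.y for \<open>sasaki_imp x y\<close>. Each axiom reduces to a lattice term of
  visible symmetry. By orthomodularity (x.y).(x.z) = inf x y . z, which is symmetric in x and y
  (\<open>sasaki_imp_imp_imp\<close>); and (x.y).(y.x) = sup x (inf (- x) (- y)), which applied to x
  gives sup x y (\<open>sasaki_imp_eq_sup\<close>). Since x.bot = - x, the term in the join axiom is
  also sup x y, so the axioms on \<open>ex\<close> carry over.\<close>

context orthomodular_lattice
begin

text \<open>Order dual of the orthomodular law, obtained by complementing it.\<close>

lemma inf_compl_sup_absorb:
  assumes "y \<le> x"
  shows "inf x (sup (- x) y) = y"
proof -
  have "sup (- x) (inf x (- y)) = - y"
    using orthomodular[of "- x" "- y"] assms by simp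
  then have "- sup (- x) (inf x (- y)) = - (- y)"
    by (rule arg_cong)
  then show ?thesis
    by simp
qed

text \<open>The instance of the Foulis--Holland theorem for \<open>c\<close> orthogonal to \<open>a\<close> and \<open>b\<close>.\<close>
lemma inf_sup_distrib_orthogonal:
  assumes "a \<le> - c" and "b \<le> - c"
  shows "inf (sup a c) (sup b c) = sup (inf a b) c"
proof -
  let ?e = "inf (sup a c) (sup b c)"
  have "inf (- c) (sup c a) = a" "inf (- c) (sup c b) = b"
    using inf_compl_sup_absorb[of a "- c"] inf_compl_sup_absorb[of b "- c"] assms by simp_all
  then have "inf (- c) ?e = inf a b"
    by (metis inf_left_commute inf.assoc inf.idem sup_commute)
  \<comment> \<open>As c lies below \<open>?e\<close>, orthomodularity recovers \<open>?e\<close>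
    from its part under \<open>- c\<close>.\<close>
  moreover have "sup c (inf (- c) ?e) = ?e"
    by (rule orthomodular) simp
  ultimately show ?thesis
    by (simp add: sup_commute)
qed

end

lemma sasaki_imp_eq_top: "x \<le> y \<Longrightarrow> sasaki_imp x y = top"
  by (simp add: sasaki_imp_def inf_absorb1)

lemma sasaki_imp_bot: "sasaki_imp x bot = - x"
  by (simp add: sasaki_imp_def)

lemma sasaki_imp_antecedent: "sasaki_imp (sasaki_imp x y) x = x"
proof -
  have "inf (sup (- x) (inf x y)) x = inf x y"
    using inf_compl_sup_absorb[of "inf x y" x] by (simp add: inf_commute)
  moreover have "sup (inf x y) (inf (- inf x y) x) = x"
    by (rule orthomodular) simp
  ultimately show ?thesis
    by (simp add: sasaki_imp_def ac_simps)
qed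

lemma sasaki_imp_imp_imp:
  "sasaki_imp (sasaki_imp x y) (sasaki_imp x z) = sasaki_imp (inf x y) z"
proof -
  have meet: "inf (sasaki_imp x y) (sasaki_imp x z) = sup (inf (inf x y) z) (- x)"
    using inf_sup_distrib_orthogonal[of "inf x y" "- x" "inf x z"]
    by (simp add: sasaki_imp_def ac_simps)
  \<comment> \<open>The complement of x.y is \<open>inf x (- inf x y)\<close>; joining
    \<open>- x\<close> rebuilds \<open>- inf x y\<close>.\<close>
  have "sup (- x) (inf x (- inf x y)) = - inf x y"
    using orthomodular[of "- x" "- inf x y"] by simp
  then have "sup (- sasaki_imp x y) (- x) = - inf x y"
    by (simp add: sasaki_imp_def sup_commute)
  then have "sup (- sasaki_imp x y) (sup (inf (inf x y) z) (- x)) = sup (- inf x y) (inf (inf x y) z)"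
    by (metis sup.assoc sup_commute)
  then show ?thesis
    by (simp only: sasaki_imp_def[of "sasaki_imp x y"] sasaki_imp_def[of "inf x y"] meet)
qed

lemma sasaki_imp_imp_converse:
  "sasaki_imp (sasaki_imp x y) (sasaki_imp y x) = sup x (inf (- x) (- y))"
proof -
  let ?m = "inf x y"
  \<comment> \<open>Here \<open>?m\<close> is the element orthogonal to both \<open>- x\<close> and
    \<open>- y\<close>.\<close>
  have meet: "inf (sasaki_imp x y) (sasaki_imp y x) = sup (inf (- x) (- y)) ?m"
    using inf_sup_distrib_orthogonal[of "- x" ?m "- y"]
    by (simp add: sasaki_imp_def inf_commute[of y x])
  have "sup ?m (inf (- ?m) x) = x"
    by (rule orthomodular) simp
  moreover have "- sasaki_imp x y = inf (- ?m) x"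
    by (simp add: sasaki_imp_def inf_commute)
  ultimately have "sup (- sasaki_imp x y) (sup (inf (- x) (- y)) ?m) = sup x (inf (- x) (- y))"
    by (metis sup.assoc sup_commute)
  then show ?thesis
    by (simp only: sasaki_imp_def[of "sasaki_imp x y"] meet)
qed

text \<open>By De Morgan the antecedent has complement \<open>inf (- x) (sup x y)\<close>, the part
  that orthomodularity adds to x to reach \<open>sup x y\<close>.\<close>

lemma sasaki_imp_eq_sup:
  "sasaki_imp (sup x (inf (- x) (- y))) x = sup x y"
proof -
  have "inf (sup x (inf (- x) (- y))) x = x"
    by (simp add: inf_absorb2)
  moreover have "sup x (inf (- x) (sup x y)) = sup x y"
    by (rule orthomodular) simp
  ultimately show ?thesis
    by (simp add: sasaki_imp_def sup_commute)
qed

lemma sup_via_sasaki_imp: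
  "sasaki_imp (sasaki_imp (sasaki_imp x bot) (sasaki_imp y bot)) x = sup x y"
  unfolding sasaki_imp_bot sasaki_imp_def[of "- x"] ortho_involution by (rule sasaki_imp_eq_sup)

theorem theorem4p5:
  fixes ex :: "'a::orthomodular_lattice \<Rightarrow> 'a"
  assumes "quantum_monadic_algebra ex"
  shows "monadic_quasi_implication_algebra sasaki_imp bot ex"
proof -
  interpret quantum_monadic_algebra ex
    by (rule assms)
  interpret quasi_implication_algebra "sasaki_imp :: 'a \<Rightarrow> 'a \<Rightarrow> 'a"
  proof
    fix x y z :: 'a
    show "sasaki_imp (sasaki_imp x y) x = x"
      by (rule sasaki_imp_antecedent)
    show "sasaki_imp (sasaki_imp x y) (sasaki_imp x z) = sasaki_imp (sasaki_imp y x) (sasaki_imp y z)"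
      by (simp only: sasaki_imp_imp_imp inf_commute)
    show "sasaki_imp (sasaki_imp (sasaki_imp x y) (sasaki_imp y x)) x =
        sasaki_imp (sasaki_imp (sasaki_imp y x) (sasaki_imp x y)) y"
      by (simp only: sasaki_imp_imp_converse sasaki_imp_eq_sup sup_commute)
  qed
  have one: "one = top"
    using imp_self[of bot] by (simp add: sasaki_imp_eq_top)
  show ?thesis
    \<comment> \<open>\<open>sup_via_sasaki_imp\<close> must act before
      \<open>sasaki_imp_bot\<close> rewrites the terms x.bot in its left-hand side.\<close>
    by unfold_locales
      (simp_all only: one sasaki_imp_eq_top bot_least ex_idem ex_increasing order_refl
        sup_via_sasaki_imp ex_sup, simp_all add: sasaki_imp_bot ex_compl ex_bot)
qed

end
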